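(* In the payment network creation game with $n$ players, betweenness weight $b\ge 0$ and closeness weight $c>1$, the price of anarchy is $\mathrm{PoA}=\mathcal{O}(1)$; i.e., there is an absolute constant $C$ such that $\mathrm{PoA}\le C$ for all $n$, all $b\ge 0$ and all $c>1$.
   Context: Payment network creation game. There are $n\ge 2$ players $[n]=\{0,1,\dots,n-1\}$. A strategy of player $u$ is a set $s_u\subseteq [n]\setminus\{u\}$ (the players to whom $u$ opens a channel). A strategy combination is $s=(s_0,\dots,s_{n-1})$, and $G[s]$ is the undirected simple graph on $[n]$ in which $u,v$ are adjacent iff $v\in s_u$ or $u\in s_v$. With weights $b\ge 0$ and $c>0$, the cost of $u$ is $$\mathrm{cost}_u(s)=|s_u|+b\cdot \mathrm{betweenness}_u(s)+c\cdot \mathrm{closeness}_u(s),$$ $$\mathrm{betweenness}_u(s)=(n-1)(n-2)-\sum_{\substack{(i,j)\in[n]^2:\ i\ne j,\ i\neq u,\ j\ne u,\\ m(i,j)>0}}\frac{m_u(i,j)}{m(i,j)},\qquad \mathrm{closeness}_u(s)=\sum_{v\in[n]\setminus\{u\}}\bigl(d_{G[s]}(u,v)-1\bigr).$$ The sum in the betweenness runs over ordered pairs; $m(i,j)$ is the number of shortest paths between $i$ and $j$ in $G[s]$ and $m_u(i,j)$ the number of those passing through $u$; $d_{G[s]}$ is graph distance, equal to $\infty$ between different components. The social cost is $\mathrm{cost}(s)=\sum_{u}\mathrm{cost}_u(s)$. A strategy combination is a Nash equilibrium if no player can strictly decrease her cost by unilaterally changing her strategy; equilibrium graphs are taken to be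 connected (a player's cost is infinite in a disconnected graph, and disconnected strategy combinations are not regarded as equilibria). With $S$ the set of all strategy combinations and $N$ the set of Nash equilibria, $\mathrm{PoA}=\dfrac{\max_{s\in N}\mathrm{cost}(s)}{\min_{s\in S}\mathrm{cost}(s)}$. *)

theory Defs
  imports "Graph_Theory.Graph_Theory"
begin

type_synonym profile = "nat \<Rightarrow> nat set"

definition players :: "nat \<Rightarrow> nat set" where
  "players n = {..<n}"

definition strategies :: "nat \<Rightarrow> nat \<Rightarrow> nat set set" where
  "strategies n u = Pow (players n - {u})"

text \<open>The extensional function space identifies a strategy combination with an \<open>n\<close>-tuple,
  so this set is finite.\<close>

definition strategy_combinations :: "nat \<Rightarrow> profile set" where
  "strategy_combinations n = (\<Pi>\<^sub>E u\<in>players n. strategies n u)"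

text \<open>An undirected graph is a symmetric digraph: each edge \<open>uv\<close> is represented by the two arcs
  \<open>(u, v)\<close> and \<open>(v, u)\<close>, and the paths from \<open>i\<close> to \<open>j\<close> are exactly the directed ones.\<close>

definition network :: "nat \<Rightarrow> profile \<Rightarrow> (nat, nat \<times> nat) pre_digraph" where
  "network n s = with_proj \<lparr> pverts = players n,
     parcs = {(u, v) \<in> players n \<times> players n. v \<in> s u \<or> u \<in> s v} \<rparr>"

lemma wf_digraph_network: "wf_digraph (network n s)"
  by unfold_locales (auto simp: network_def)

lemma graph_network:
  assumes "s \<in> strategy_combinations n"
  shows "graph (network n s)"
proof -
  have "finite {(u, v) \<in> players n \<times> players n. v \<in> s u \<or> u \<in> s v}"
    by (rule finite_subset[of _ "players n \<times> players n"]) (auto simp: players_def)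
  moreover have "u \<notin> s u" if "u \<in> players n" for u
    using assms that by (fastforce simp: strategy_combinations_def strategies_def PiE_iff)
  ultimately show ?thesis
    by unfold_locales
      (auto simp: network_def players_def arc_to_ends_def symmetric_def arcs_ends_def sym_def
        image_iff)
qed

text \<open>\<open>\<mu>\<close> is an infimum over walks, hence \<open>\<infinity>\<close> between different components.\<close>

definition distance :: "nat \<Rightarrow> profile \<Rightarrow> nat \<Rightarrow> nat \<Rightarrow> ereal" where
  "distance n s u v = wf_digraph.\<mu> (network n s) (\<lambda>_. 1) u v"

definition shortest_paths :: "nat \<Rightarrow> profile \<Rightarrow> nat \<Rightarrow> nat \<Rightarrow> (nat \<times> nat) awalk set" where
  "shortest_paths n s i j =
     {p. pre_digraph.apath (network n s) i p j \<and> ereal (real (length p)) = distance n s i j}"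

definition num_paths :: "nat \<Rightarrow> profile \<Rightarrow> nat \<Rightarrow> nat \<Rightarrow> nat" where
  "num_paths n s i j = card (shortest_paths n s i j)"

definition num_paths_through :: "nat \<Rightarrow> profile \<Rightarrow> nat \<Rightarrow> nat \<Rightarrow> nat \<Rightarrow> nat" where
  "num_paths_through n s u i j =
     card {p \<in> shortest_paths n s i j. u \<in> set (pre_digraph.awalk_verts (network n s) i p)}"

definition betweenness :: "nat \<Rightarrow> profile \<Rightarrow> nat \<Rightarrow> real" where
  "betweenness n s u = (real n - 1) * (real n - 2) -
     (\<Sum>(i, j) \<in> {(i, j) \<in> players n \<times> players n.
          i \<noteq> j \<and> i \<noteq> u \<and> j \<noteq> u \<and> num_paths n s i j > 0}.
        real (num_paths_through n s u i j) / real (num_paths n s i j))"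

definition closeness :: "nat \<Rightarrow> profile \<Rightarrow> nat \<Rightarrow> ereal" where
  "closeness n s u = (\<Sum>v \<in> players n - {u}. distance n s u v - 1)"

definition player_cost :: "nat \<Rightarrow> real \<Rightarrow> real \<Rightarrow> profile \<Rightarrow> nat \<Rightarrow> ereal" where
  "player_cost n b c s u =
     ereal (real (card (s u))) + ereal b * ereal (betweenness n s u) + ereal c * closeness n s u"

definition social_cost :: "nat \<Rightarrow> real \<Rightarrow> real \<Rightarrow> profile \<Rightarrow> ereal" where
  "social_cost n b c s = (\<Sum>u \<in> players n. player_cost n b c s u)"

text \<open>Connectedness is required explicitly: if no single player can reconnect a disconnected
  graph, every unilateral deviation costs \<open>\<infinity>\<close>, so none is strictly improving.\<close>

definition nash_equilibrium :: "nat \<Rightarrow> real \<Rightarrow> real \<Rightarrow> profile \<Rightarrow> bool" where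
  "nash_equilibrium n b c s \<longleftrightarrow>
     s \<in> strategy_combinations n \<and> connected (network n s) \<and>
     (\<forall>u \<in> players n. \<forall>t \<in> strategies n u.
        \<not> player_cost n b c (s(u := t)) u < player_cost n b c s u)"

text \<open>\<open>Max\<close> is unspecified on the empty set, so a bound on this quantity is informative only
  where an equilibrium exists, and cannot be obtained vacuously where none does
  (as it could with \<open>Sup\<close>).\<close>

definition price_of_anarchy :: "nat \<Rightarrow> real \<Rightarrow> real \<Rightarrow> ereal" where
  "price_of_anarchy n b c =
     Max (social_cost n b c ` {s. nash_equilibrium n b c s}) /
     Min (social_cost n b c ` strategy_combinations n)"

end

theory Submission
  imports Defs
begin

text \<open>
  For \<open>c > 1\<close>, connecting to a non-neighbour \<open>v\<close> costs \<open>u\<close> one unit, saves her at least \<open>c\<close> in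
  closeness and does not worsen her betweenness, so every equilibrium graph is complete and its social
  cost is at most \<open>n (n - 1) + b n (n - 1) (n - 2)\<close>. The complete graph in which every edge is paid
  for once is an equilibrium, since edge deletions lose more closeness than they save.

  Half of this cost is a lower bound for every strategy combination. For a pair of players, a missing
  edge costs each of them at least \<open>c\<close> in closeness and a present one is paid for at least once. For
  distinct \<open>u\<close>, \<open>i\<close>, \<open>j\<close>, the fractions of shortest paths from \<open>i\<close> to \<open>j\<close> through \<open>u\<close> and of those from
  \<open>u\<close> to \<open>j\<close> through \<open>i\<close> cannot both be positive, so at least half of the betweenness term is unavoidable.
  Hence the bound \<open>2\<close>.
\<close>

section \<open>Networks and the transfer of walks between them\<close>

abbreviation adjacent :: "profile \<Rightarrow> nat \<Rightarrow> nat \<Rightarrow> bool" where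
  "adjacent s u v \<equiv> v \<in> s u \<or> u \<in> s v"

lemma verts_network [simp]: "verts (network n s) = players n"
  and arcs_network [simp]: "arcs (network n s) = {(u, v) \<in> players n \<times> players n. adjacent s u v}"
  and tail_network [simp]: "tail (network n s) = fst"
  and head_network [simp]: "head (network n s) = snd"
  by (simp_all add: network_def)

lemma finite_players [simp]: "finite (players n)"
  and card_players [simp]: "card (players n) = n"
  by (simp_all add: players_def)

text \<open>Stated for arbitrary profiles: loops, which \<open>graph_network\<close> has to exclude,
  do not affect finiteness.\<close>

lemma fin_digraph_network: "fin_digraph (network n s)"
proof -
  interpret wf_digraph "network n s" by (rule wf_digraph_network)
  have "finite {(u, v) \<in> players n \<times> players n. adjacent s u v}"
    by (rule finite_subset[of _ "players n \<times> players n"]) auto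
  then show ?thesis
    by unfold_locales simp_all
qed

lemma symmetric_network: "symmetric (network n s)"
  by (auto simp: symmetric_def arcs_ends_def arc_to_ends_def sym_def image_iff)

lemma awalk_verts_network:
  "pre_digraph.awalk_verts (network n s) u p = (if p = [] then [u] else map fst p @ [snd (last p)])"
  by (simp add: pre_digraph.awalk_verts_conv)

text \<open>All networks share the tail and head functions \<open>fst\<close> and
  \<open>snd\<close>, so whether a list of arcs is a chain does not depend on the profile. Hence a
  walk moves to any network that contains its arcs.\<close>

lemma cas_network:
  "pre_digraph.cas (network n s) u p v = pre_digraph.cas (network n s') u p v"
proof (induction p arbitrary: u)
  case (Cons e p)
  then show ?case by (simp add: pre_digraph.cas.simps)
qed (simp add: pre_digraph.cas.simps)

lemma awalk_network_transfer:
  assumes "pre_digraph.awalk (network n s) i p j" "set p \<subseteq> arcs (network n s')"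
  shows "pre_digraph.awalk (network n s') i p j"
  using assms cas_network[of n s i p j s'] by (simp add: pre_digraph.awalk_def)

lemma apath_network_transfer:
  assumes "pre_digraph.apath (network n s) i p j" "set p \<subseteq> arcs (network n s')"
  shows "pre_digraph.apath (network n s') i p j"
  using assms awalk_network_transfer[of n s i p j s']
  by (simp add: pre_digraph.apath_def awalk_verts_network)

lemma awalk_cost_one: "wf_digraph.awalk_cost (\<lambda>_. 1) (p :: (nat \<times> nat) awalk) = real (length p)"
  \<comment> \<open>The cost of a walk ignores the graph, so any network can discharge the locale
    assumption.\<close>
  by (simp add: wf_digraph.awalk_cost_def[OF wf_digraph_network] sum_list_triv)

section \<open>Distances and shortest paths\<close>

lemma distance_le_length:
  assumes "pre_digraph.awalk (network n s) i p j"
  shows "distance n s i j \<le> ereal (real (length p))"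
  using wf_digraph.min_cost_le_walk_cost[OF wf_digraph_network assms, of "\<lambda>_. 1"]
  by (simp add: distance_def awalk_cost_one)

text \<open>If there is no walk, the premise is vacuous and the distance infinite, so the rule also
  covers different components.\<close>

lemma le_distanceI:
  assumes "\<And>p. pre_digraph.awalk (network n s) i p j \<Longrightarrow> k \<le> ereal (real (length p))"
  shows "k \<le> distance n s i j"
  unfolding distance_def wf_digraph.\<mu>_def[OF wf_digraph_network]
  by (rule INF_greatest) (simp add: awalk_cost_one assms)

text \<open>In a finite digraph with nonnegative weights the infimum over walks to a reachable
  vertex is attained by a path.\<close>

lemma shortest_paths_nonempty:
  assumes "pre_digraph.awalk (network n s) i p j"
  shows "shortest_paths n s i j \<noteq> {}"
proof -
  interpret fin_digraph "network n s" by (rule fin_digraph_network)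
  have "i \<rightarrow>\<^sup>*\<^bsub>network n s\<^esub> j" using assms by (rule reachable_awalkI)
  from min_cost_awalk[OF this, of "\<lambda>_. 1"] show ?thesis
    by (auto simp: shortest_paths_def distance_def awalk_cost_one)
qed

lemma finite_shortest_paths [simp]: "finite (shortest_paths n s i j)"
  by (rule finite_subset[OF _ fin_digraph.apaths_finite[OF fin_digraph_network, of n s i j]])
    (auto simp: shortest_paths_def)

lemma awalk_length_eq_0:
  "pre_digraph.awalk (network n s) i p j \<Longrightarrow> length p = 0 \<Longrightarrow> i = j"
  by (simp add: pre_digraph.awalk_def pre_digraph.cas.simps)

lemma awalk_length_eq_1:
  "pre_digraph.awalk (network n s) i p j \<Longrightarrow> length p = 1 \<Longrightarrow> adjacent s i j"
  by (auto simp: pre_digraph.awalk_def pre_digraph.cas.simps length_Suc_conv)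

lemma distance_ge_1:
  assumes "i \<noteq> j"
  shows "1 \<le> distance n s i j"
proof (rule le_distanceI)
  fix p assume "pre_digraph.awalk (network n s) i p j"
  with assms awalk_length_eq_0[of n s i p j] have "1 \<le> length p" by linarith
  then show "1 \<le> ereal (real (length p))" by (simp add: one_ereal_def)
qed

lemma distance_diff_1_nonneg: "i \<noteq> j \<Longrightarrow> 0 \<le> distance n s i j - 1"
  by (rule ereal_diff_positive[OF distance_ge_1])

lemma distance_ge_2:
  assumes "i \<noteq> j" "\<not> adjacent s i j"
  shows "2 \<le> distance n s i j"
proof (rule le_distanceI)
  fix p assume "pre_digraph.awalk (network n s) i p j"
  with assms awalk_length_eq_0[of n s i p j] awalk_length_eq_1[of n s i p j]
  have "2 \<le> length p" by linarith
  then show "2 \<le> ereal (real (length p))" by simp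
qed

lemma distance_adjacent:
  assumes "adjacent s i j" "i \<in> players n" "j \<in> players n" "i \<noteq> j"
  shows "distance n s i j = 1"
proof -
  have "pre_digraph.awalk (network n s) i [(i, j)] j"
    using assms by (simp add: pre_digraph.awalk_def pre_digraph.cas.simps)
  from distance_le_length[OF this] distance_ge_1[OF assms(4), of n s] show ?thesis
    by (simp add: one_ereal_def)
qed

text \<open>Walks survive the addition of arcs, so the infimum is taken over a larger set.\<close>

lemma distance_mono:
  assumes "arcs (network n s) \<subseteq> arcs (network n s')"
  shows "distance n s' i j \<le> distance n s i j"
proof (rule le_distanceI)
  fix p assume p: "pre_digraph.awalk (network n s) i p j"
  then have "set p \<subseteq> arcs (network n s')"
    using assms by (auto simp: pre_digraph.awalk_def)
  then show "distance n s' i j \<le> ereal (real (length p))"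
    by (intro distance_le_length awalk_network_transfer[OF p])
qed

lemma distance_finite:
  assumes "connected (network n s)" "i \<in> players n" "j \<in> players n"
  shows "distance n s i j \<noteq> \<infinity>"
proof -
  interpret fin_digraph "network n s" by (rule fin_digraph_network)
  \<comment> \<open>\<open>connected\<close> refers to the symmetric closure; symmetry of the
    network turns it into directed reachability.\<close>
  have "i \<rightarrow>\<^sup>*\<^bsub>network n s\<^esub> j"
    using assms symmetric_connected_imp_strongly_connected[OF symmetric_network]
    by (auto simp: strongly_connected_def)
  then obtain p where "awalk i p j" by (auto simp: reachable_awalk)
  from distance_le_length[OF this] show ?thesis by auto
qed

section \<open>Fractions of shortest paths and betweenness\<close>

definition fraction_through :: "nat \<Rightarrow> profile \<Rightarrow> nat \<Rightarrow> nat \<Rightarrow> nat \<Rightarrow> real" where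
  "fraction_through n s u i j =
     real (num_paths_through n s u i j) / real (num_paths n s i j)"

lemma num_paths_through_le: "num_paths_through n s u i j \<le> num_paths n s i j"
  unfolding num_paths_through_def num_paths_def by (rule card_mono) auto

lemma fraction_through_nonneg [simp]: "0 \<le> fraction_through n s u i j"
  by (simp add: fraction_through_def)

lemma fraction_through_le_1: "fraction_through n s u i j \<le> 1"
  using num_paths_through_le[of n s u i j]
  by (cases "num_paths n s i j = 0") (simp_all add: fraction_through_def)

text \<open>Division by 0 yields 0, so pairs without a path may join the sum. This leaves nested
  sums over all distinct players, which can be reindexed.\<close>

lemma betweenness_eq:
  "betweenness n s u = (real n - 1) * (real n - 2) -
     (\<Sum>i \<in> players n - {u}. \<Sum>j \<in> players n - {u, i}. fraction_through n s u i j)"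
proof -
  have "(\<Sum>(i, j) \<in> {(i, j) \<in> players n \<times> players n.
            i \<noteq> j \<and> i \<noteq> u \<and> j \<noteq> u \<and> num_paths n s i j > 0}. fraction_through n s u i j) =
        (\<Sum>(i, j) \<in> Sigma (players n - {u}) (\<lambda>i. players n - {u, i}). fraction_through n s u i j)"
    by (rule sum.mono_neutral_left) (auto simp: fraction_through_def)
  then show ?thesis
    by (simp add: betweenness_def sum.Sigma flip: fraction_through_def)
qed

lemma betweenness_le: "betweenness n s u \<le> (real n - 1) * (real n - 2)"
  unfolding betweenness_eq by (simp add: sum_nonneg)

text \<open>Cut a shortest path from \<open>i\<close> to \<open>j\<close> at \<open>u\<close>: since
  \<open>u\<close> differs from \<open>i\<close>, the first piece is nonempty and the second is
  strictly shorter than the whole.\<close>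

lemma distance_less_of_through:
  assumes "num_paths_through n s u i j > 0" "u \<noteq> i"
  shows "distance n s u j < distance n s i j"
proof -
  interpret wf_digraph "network n s" by (rule wf_digraph_network)
  from assms(1) obtain p where p: "apath i p j" "u \<in> set (awalk_verts i p)"
      and d: "ereal (real (length p)) = distance n s i j"
    by (auto simp: num_paths_through_def shortest_paths_def card_gt_0_iff)
  from awalk_decomp[OF awalkI_apath[OF p(1)] p(2)] obtain q r
    where qr: "p = q @ r" "awalk i q u" "awalk u r j" by blast
  with assms(2) have "length r < length p" by (auto simp: awalk_Nil_iff)
  moreover have "distance n s u j \<le> ereal (real (length r))"
    using qr(3) by (rule distance_le_length)
  ultimately show ?thesis
    unfolding d[symmetric] by (simp add: order_le_less_trans)
qed

text \<open>At most one of \<open>u\<close> and \<open>i\<close> can lie between the other one and \<open>j\<close>.\<close>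

lemma fraction_through_swap:
  assumes "u \<noteq> i"
  shows "fraction_through n s u i j + fraction_through n s i u j \<le> 1"
proof -
  have "num_paths_through n s u i j = 0 \<or> num_paths_through n s i u j = 0"
  proof (rule ccontr)
    assume "\<not> ?thesis"
    then have "distance n s u j < distance n s i j" "distance n s i j < distance n s u j"
      using assms by (auto intro: distance_less_of_through)
    then show False by simp
  qed
  then show ?thesis
    using fraction_through_le_1[of n s u i j] fraction_through_le_1[of n s i u j]
    by (auto simp: fraction_through_def)
qed

text \<open>Double counting of ordered pairs, used both for betweenness and for counting paid
  edges.\<close>

lemma sum_off_diagonal_swap:
  fixes f :: "'a \<Rightarrow> 'a \<Rightarrow> 'b :: comm_monoid_add"
  assumes "finite A"
  shows "(\<Sum>x\<in>A. \<Sum>y\<in>A - {x}. f x y) = (\<Sum>x\<in>A. \<Sum>y\<in>A - {x}. f y x)"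
proof -
  have "(\<Sum>x\<in>A. \<Sum>y\<in>A - {x}. f x y) = (\<Sum>x\<in>A. \<Sum>y\<in>{y. y \<in> A \<and> x \<noteq> y}. f x y)"
    by (intro sum.cong) auto
  also have "\<dots> = (\<Sum>y\<in>A. \<Sum>x\<in>{x. x \<in> A \<and> x \<noteq> y}. f x y)"
    by (rule sum.swap_restrict[OF assms assms])
  also have "\<dots> = (\<Sum>x\<in>A. \<Sum>y\<in>A - {x}. f y x)"
    by (intro sum.cong) auto
  finally show ?thesis .
qed

text \<open>The leading terms add up to \<open>n (n - 1) (n - 2)\<close>. Pairing the triples
  \<open>(u, i, j)\<close> and \<open>(i, u, j)\<close> shows that the subtracted fractions add up
  to at most half of this.\<close>

lemma sum_betweenness_ge:
  assumes "n \<ge> 2"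
  shows "real n * (real n - 1) * (real n - 2) / 2 \<le> (\<Sum>u\<in>players n. betweenness n s u)"
proof -
  let ?P = "players n"
  define F where "F u i = (\<Sum>j\<in>?P - {u, i}. fraction_through n s u i j)" for u i
  have *: "F u i + F i u \<le> real n - 2" if "u \<in> ?P" "i \<in> ?P - {u}" for u i
  proof -
    have "F u i + F i u =
        (\<Sum>j\<in>?P - {u, i}. fraction_through n s u i j + fraction_through n s i u j)"
      by (simp add: F_def sum.distrib insert_commute)
    also have "\<dots> \<le> (\<Sum>j\<in>?P - {u, i}. 1)"
      using that by (intro sum_mono fraction_through_swap) auto
    also have "\<dots> = real n - 2"
      using that assms by (simp add: card_Diff_subset)
    finally show ?thesis .
  qed
  \<comment> \<open>The second copy of the sum is taken with \<open>u\<close> and \<open>i\<close>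
    exchanged.\<close>
  have "2 * (\<Sum>u\<in>?P. \<Sum>i\<in>?P - {u}. F u i) = (\<Sum>u\<in>?P. \<Sum>i\<in>?P - {u}. F u i + F i u)"
    using sum_off_diagonal_swap[of ?P F] by (simp add: sum.distrib)
  also have "\<dots> \<le> (\<Sum>u\<in>?P. \<Sum>i\<in>?P - {u}. real n - 2)"
    by (intro sum_mono *)
  also have "\<dots> = real n * (real n - 1) * (real n - 2)"
    using assms by (simp add: algebra_simps of_nat_diff)
  finally show ?thesis
    by (simp add: betweenness_eq sum_subtractf flip: F_def)
qed

section \<open>Lower bound for edges and closeness\<close>

lemma closeness_nonneg: "0 \<le> closeness n s u"
  unfolding closeness_def by (intro sum_nonneg distance_diff_1_nonneg) auto

text \<open>If \<open>v\<close> does not pay for the edge \<open>uv\<close>, then either \<open>u\<close> pays for it or the distance is at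
  least \<open>2\<close> and contributes at least \<open>c\<close>.\<close>

lemma edge_closeness_cost_ge:
  assumes "c \<ge> 1" "s u \<in> strategies n u"
  shows "ereal (real (card {v \<in> players n - {u}. u \<notin> s v})) \<le>
    ereal (real (card (s u))) + ereal c * closeness n s u"
proof -
  let ?A = "players n - {u}" and ?N = "{v \<in> players n - {u}. u \<notin> s v}"
  have su: "s u \<subseteq> ?A" using assms(2) by (auto simp: strategies_def)
  then have fin: "finite (s u)" by (rule finite_subset) simp
  \<comment> \<open>For \<open>v\<close> in this set neither endpoint pays for the edge, so
    \<open>v\<close> is not a neighbour of \<open>u\<close>.\<close>
  have "ereal (real (card (?N - s u))) = (\<Sum>v\<in>?N - s u. 1)"
    unfolding one_ereal_def sum_ereal by simp
  also have "\<dots> \<le> (\<Sum>v\<in>?N - s u. distance n s u v - 1)"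
  proof (rule sum_mono)
    fix v assume "v \<in> ?N - s u"
    then have "2 \<le> distance n s u v" by (intro distance_ge_2) auto
    then show "1 \<le> distance n s u v - 1"
      by (cases "distance n s u v") (auto simp: one_ereal_def)
  qed
  also have "\<dots> \<le> closeness n s u"
    unfolding closeness_def
    by (intro sum_mono2 distance_diff_1_nonneg) auto
  also have "\<dots> \<le> ereal c * closeness n s u"
    using ereal_mult_right_mono[OF _ closeness_nonneg, of 1 "ereal c" n s u] assms(1)
    by (simp add: one_ereal_def)
  finally have le: "ereal (real (card (?N - s u))) \<le> ereal c * closeness n s u" .
  have "?N \<subseteq> s u \<union> (?N - s u)" by auto
  then have "card ?N \<le> card (s u \<union> (?N - s u))" by (intro card_mono) (auto simp: fin)
  also have "\<dots> \<le> card (s u) + card (?N - s u)" by (rule card_Un_le)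
  finally have "ereal (real (card ?N)) \<le> ereal (real (card (s u))) + ereal (real (card (?N - s u)))"
    by simp
  also have "\<dots> \<le> ereal (real (card (s u))) + ereal c * closeness n s u"
    by (rule add_left_mono[OF le])
  finally show ?thesis .
qed

text \<open>With \<open>E\<close> the number of payments, the sum is at least \<open>E\<close>
  because closeness is nonnegative, and at least \<open>n (n - 1) - E\<close> by
  \<open>edge_closeness_cost_ge\<close>. The larger of the two bounds is at least their
  average.\<close>

lemma sum_edge_closeness_cost_ge:
  assumes "c \<ge> 1" "s \<in> strategy_combinations n" "n \<ge> 2"
  shows "ereal (real n * (real n - 1) / 2) \<le>
    (\<Sum>u\<in>players n. ereal (real (card (s u))) + ereal c * closeness n s u)"
proof -
  let ?P = "players n"
  let ?X = "\<Sum>u\<in>?P. ereal (real (card (s u))) + ereal c * closeness n s u"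
  define E where "E = (\<Sum>u\<in>?P. real (card (s u)))"
  have strat: "s u \<in> strategies n u" if "u \<in> ?P" for u
    using assms(2) that by (auto simp: strategy_combinations_def)
  have "ereal E = (\<Sum>u\<in>?P. ereal (real (card (s u))))"
    by (simp add: E_def)
  also have "\<dots> \<le> ?X"
  proof (rule sum_mono)
    fix u
    have "0 \<le> ereal c * closeness n s u"
      using assms(1) closeness_nonneg[of n s u] by simp
    then show "ereal (real (card (s u))) \<le> ereal (real (card (s u))) + ereal c * closeness n s u"
      by (metis add.right_neutral add_left_mono)
  qed
  finally have 1: "ereal E \<le> ?X" .
  \<comment> \<open>Exchanging the roles counts, for each \<open>u\<close>, the players she does not
    pay for instead of those who do not pay for her.\<close>
  have "(\<Sum>u\<in>?P. real (card {v \<in> ?P - {u}. u \<notin> s v}))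
      = (\<Sum>u\<in>?P. \<Sum>v\<in>?P - {u}. of_bool (u \<notin> s v))"
    by (intro sum.cong) (auto simp: of_bool_def sum.If_cases Int_def)
  also have "\<dots> = (\<Sum>u\<in>?P. \<Sum>v\<in>?P - {u}. of_bool (v \<notin> s u))"
    by (rule sum_off_diagonal_swap) simp
  also have "\<dots> = (\<Sum>u\<in>?P. (real n - 1) - real (card (s u)))"
  proof (rule sum.cong)
    fix u assume u: "u \<in> ?P"
    then have sub: "s u \<subseteq> ?P - {u}" using strat by (auto simp: strategies_def)
    have "(\<Sum>v\<in>?P - {u}. of_bool (v \<notin> s u)) = real (card ((?P - {u}) - s u))"
      by (auto simp: of_bool_def sum.If_cases Int_def set_diff_eq intro!: arg_cong[where f = card])
    also have "\<dots> = real (card (?P - {u})) - real (card (s u))"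
      using sub by (simp add: card_Diff_subset finite_subset[OF sub] card_mono of_nat_diff del: card_Diff_insert)
    also have "real (card (?P - {u})) = real n - 1"
      using u assms(3) by (simp add: of_nat_diff)
    finally show "(\<Sum>v\<in>?P - {u}. of_bool (v \<notin> s u)) = (real n - 1) - real (card (s u))" .
  qed simp
  also have "\<dots> = real n * (real n - 1) - E"
    by (simp add: sum_subtractf E_def)
  finally have "ereal (real n * (real n - 1) - E)
      = (\<Sum>u\<in>?P. ereal (real (card {v \<in> ?P - {u}. u \<notin> s v})))"
    by simp
  also have "\<dots> \<le> ?X"
    by (intro sum_mono edge_closeness_cost_ge assms strat)
  finally have 2: "ereal (real n * (real n - 1) - E) \<le> ?X" .
  \<comment> \<open>Choosing the larger bound by cases avoids averaging with a sum that may be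
    infinite.\<close>
  show ?thesis
  proof (cases "E \<ge> real n * (real n - 1) / 2")
    case True
    then show ?thesis using 1 by (meson ereal_less_eq(3) order_trans)
  next
    case False
    then have "real n * (real n - 1) / 2 \<le> real n * (real n - 1) - E" by simp
    then show ?thesis using 2 by (meson ereal_less_eq(3) order_trans)
  qed
qed

section \<open>Bounds on the social cost\<close>

text \<open>The edge term counts every edge as paid for by both endpoints.\<close>

definition complete_cost :: "nat \<Rightarrow> real \<Rightarrow> real" where
  "complete_cost n b = real n * ((real n - 1) + b * ((real n - 1) * (real n - 2)))"

text \<open>Adds the bounds for edges with closeness and for betweenness; each is half of the
  matching part of \<open>complete_cost\<close>.\<close>

lemma social_cost_ge:
  assumes "c \<ge> 1" "b \<ge> 0" "s \<in> strategy_combinations n" "n \<ge> 2"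
  shows "ereal (complete_cost n b / 2) \<le> social_cost n b c s"
proof -
  let ?P = "players n"
  have "b * (real n * (real n - 1) * (real n - 2) / 2) \<le> b * (\<Sum>u\<in>?P. betweenness n s u)"
    by (intro mult_left_mono sum_betweenness_ge assms)
  then have "ereal (b * (real n * (real n - 1) * (real n - 2) / 2))
      \<le> (\<Sum>u\<in>?P. ereal b * ereal (betweenness n s u))"
    by (simp only: times_ereal.simps sum_ereal sum_distrib_left ereal_less_eq)
  from add_mono[OF sum_edge_closeness_cost_ge[OF assms(1,3,4)] this]
  have "ereal (real n * (real n - 1) / 2 + b * (real n * (real n - 1) * (real n - 2) / 2)) \<le>
      (\<Sum>u\<in>?P. ereal (real (card (s u))) + ereal c * closeness n s u) +
      (\<Sum>u\<in>?P. ereal b * ereal (betweenness n s u))"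
    by (simp only: plus_ereal.simps)
  also have "\<dots> = social_cost n b c s"
    by (simp only: social_cost_def player_cost_def sum.distrib ac_simps)
  finally have "ereal (real n * (real n - 1) / 2 + b * (real n * (real n - 1) * (real n - 2) / 2))
      \<le> social_cost n b c s" .
  moreover have "real n * (real n - 1) / 2 + b * (real n * (real n - 1) * (real n - 2) / 2)
      = complete_cost n b / 2"
    by (simp add: complete_cost_def field_simps)
  ultimately show ?thesis by (simp only:)
qed

text \<open>Closeness vanishes in a complete graph, and trivial bounds on the other two terms
  suffice. Edges paid for by both endpoints are allowed.\<close>

lemma social_cost_complete_le:
  assumes "b \<ge> 0" "s \<in> strategy_combinations n" "n \<ge> 2"
    and adj: "\<And>u v. u \<in> players n \<Longrightarrow> v \<in> players n \<Longrightarrow> u \<noteq> v \<Longrightarrow> adjacent s u v"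
  shows "social_cost n b c s \<le> ereal (complete_cost n b)"
proof -
  let ?P = "players n"
  have "player_cost n b c s u \<le> ereal ((real n - 1) + b * ((real n - 1) * (real n - 2)))"
    if u: "u \<in> ?P" for u
  proof -
    have "closeness n s u = 0"
      unfolding closeness_def
      by (intro sum.neutral ballI) (use adj u in \<open>simp add: distance_adjacent one_ereal_def\<close>)
    moreover have "s u \<subseteq> ?P - {u}"
      using assms(2) u by (auto simp: strategy_combinations_def strategies_def)
    then have "card (s u) \<le> card (?P - {u})" by (intro card_mono) auto
    then have "real (card (s u)) \<le> real n - 1"
      using u assms(3) by simp
    moreover have "b * betweenness n s u \<le> b * ((real n - 1) * (real n - 2))"
      by (intro mult_left_mono betweenness_le assms)
    ultimately show ?thesis by (simp add: player_cost_def)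
  qed
  then have "social_cost n b c s
      \<le> (\<Sum>u\<in>?P. ereal ((real n - 1) + b * ((real n - 1) * (real n - 2))))"
    unfolding social_cost_def by (rule sum_mono)
  then show ?thesis by (simp add: complete_cost_def)
qed

section \<open>Equilibrium graphs are complete\<close>

text \<open>New shortest paths all use the new edge and hence pass through its endpoint \<open>u\<close>.\<close>

lemma fraction_through_mono:
  assumes sub: "arcs (network n s) \<subseteq> arcs (network n s')"
    and inc: "\<And>x y. (x, y) \<in> arcs (network n s') \<Longrightarrow> x \<noteq> u \<Longrightarrow> y \<noteq> u \<Longrightarrow>
      (x, y) \<in> arcs (network n s)"
  shows "fraction_through n s u i j \<le> fraction_through n s' u i j"
proof -
  \<comment> \<open>The vertex sequence of a list of arcs is the same in all networks, so
    \<open>V\<close> serves both profiles.\<close>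
  define V where "V p = set (pre_digraph.awalk_verts (network n s) i p)" for p
  have V': "set (pre_digraph.awalk_verts (network n s') i p) = V p" for p
    by (simp add: V_def awalk_verts_network)
  \<comment> \<open>The fraction through \<open>u\<close> is 1 minus the fraction avoiding
    \<open>u\<close>, and the latter is easier to compare.\<close>
  define Q where "Q t = {p \<in> shortest_paths n t i j. u \<notin> V p}" for t
  have fin: "finite (Q t)" for t by (simp add: Q_def)
  have split: "num_paths n t i j = card {p \<in> shortest_paths n t i j. u \<in> V p} + card (Q t)" for t
  proof -
    have "shortest_paths n t i j = {p \<in> shortest_paths n t i j. u \<in> V p} \<union> Q t"
      by (auto simp: Q_def)
    then have "card (shortest_paths n t i j) = card ({p \<in> shortest_paths n t i j. u \<in> V p} \<union> Q t)"
      by simp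
    also have "\<dots> = card {p \<in> shortest_paths n t i j. u \<in> V p} + card (Q t)"
      by (rule card_Un_disjoint) (auto simp: Q_def)
    finally show ?thesis by (simp add: num_paths_def)
  qed
  have frac: "fraction_through n t u i j = 1 - real (card (Q t)) / real (num_paths n t i j)"
    if "num_paths n t i j > 0" "t = s \<or> t = s'" for t
  proof -
    have "num_paths_through n t u i j = card {p \<in> shortest_paths n t i j. u \<in> V p}"
      using that(2) by (auto simp: num_paths_through_def V' V_def[symmetric])
    then have "real (num_paths_through n t u i j) = real (num_paths n t i j) - real (card (Q t))"
      using split[of t] by simp
    then show ?thesis
      using that(1) by (simp add: fraction_through_def diff_divide_distrib)
  qed
  have mono: "distance n s' i j \<le> distance n s i j" by (rule distance_mono[OF sub])
  have apath_mono: "pre_digraph.apath (network n s') i p j"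
    if p: "pre_digraph.apath (network n s) i p j" for p
  proof -
    have "set p \<subseteq> arcs (network n s)"
      using p by (simp add: pre_digraph.apath_def pre_digraph.awalk_def)
    with sub show ?thesis by (intro apath_network_transfer[OF p]) auto
  qed
  show ?thesis
  proof (cases "Q s' = {}")
    \<comment> \<open>Either the fraction for \<open>s'\<close> is 1, or neither profile has a path
      from \<open>i\<close> to \<open>j\<close> and both fractions are 0.\<close>
    case True
    show ?thesis
    proof (cases "num_paths n s' i j = 0")
      case True
      then have none: "shortest_paths n s' i j = {}" by (simp add: num_paths_def)
      have "shortest_paths n s i j = {}"
      proof (rule ccontr)
        assume "shortest_paths n s i j \<noteq> {}"
        then obtain p where "pre_digraph.apath (network n s) i p j"
          by (auto simp: shortest_paths_def)
        from apath_mono[OF this] have "pre_digraph.awalk (network n s') i p j"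
          by (simp add: pre_digraph.apath_def)
        from shortest_paths_nonempty[OF this] none show False by simp
      qed
      then show ?thesis by (simp add: fraction_through_def num_paths_def)
    next
      case False
      then have "fraction_through n s' u i j = 1"
        using frac[of s'] True by simp
      then show ?thesis by (simp add: fraction_through_le_1)
    qed
  next
    case False
    \<comment> \<open>A path avoiding \<open>u\<close> uses only arcs already present in
      \<open>s\<close>. If one is shortest in \<open>s'\<close>, the distance is therefore the same
      in both networks.\<close>
    have Q': "pre_digraph.apath (network n s) i p j" if p: "p \<in> Q s'" for p
    proof -
      interpret wf_digraph "network n s'" by (rule wf_digraph_network)
      have ap: "apath i p j" and u: "u \<notin> V p"
        using p by (auto simp: Q_def shortest_paths_def)
      then have w: "awalk i p j" by (simp add: apath_def)
      have "set p \<subseteq> arcs (network n s)"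
      proof
        fix e assume e: "e \<in> set p"
        have "e \<in> arcs (network n s')" using w e by (auto simp: awalk_def)
        moreover have "fst e \<noteq> u" "snd e \<noteq> u"
          using awalk_verts_arc1[OF e, of i] awalk_verts_arc2[OF w e] u by (auto simp: V')
        ultimately show "e \<in> arcs (network n s)" using inc[of "fst e" "snd e"] by simp
      qed
      then show ?thesis by (rule apath_network_transfer[OF ap])
    qed
    from False obtain p where p: "p \<in> Q s'" by auto
    have "distance n s i j \<le> ereal (real (length p))"
      using Q'[OF p] by (intro distance_le_length) (simp add: pre_digraph.apath_def)
    also have "\<dots> = distance n s' i j" using p by (auto simp: Q_def shortest_paths_def)
    finally have d: "distance n s i j = distance n s' i j" using mono by simp
    have "Q s' \<subseteq> Q s"
      using Q' d by (auto simp: Q_def shortest_paths_def)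
    then have Qle: "card (Q s') \<le> card (Q s)" by (intro card_mono fin)
    \<comment> \<open>At equal distance all old shortest paths stay shortest, so passing to
      \<open>s'\<close> can only enlarge the denominator, while no avoiding path is new.\<close>
    have "shortest_paths n s i j \<subseteq> shortest_paths n s' i j"
      using apath_mono d by (auto simp: shortest_paths_def)
    then have mle: "num_paths n s i j \<le> num_paths n s' i j"
      unfolding num_paths_def by (intro card_mono) auto
    have "card (Q s') > 0" using p fin by (auto simp: card_gt_0_iff)
    then have pos: "num_paths n s i j > 0" using Qle split[of s] by linarith
    have "real (card (Q s')) / real (num_paths n s' i j) \<le> real (card (Q s)) / real (num_paths n s i j)"
      by (rule frac_le) (use Qle mle pos in auto)
    then show ?thesis using frac[of s] frac[of s'] pos mle by simp
  qed
qed

lemma nash_equilibrium_adjacent: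
  assumes nash: "nash_equilibrium n b c s" and "c > 1" "b \<ge> 0"
    and u: "u \<in> players n" and v: "v \<in> players n" and "u \<noteq> v"
  shows "adjacent s u v"
proof (rule ccontr)
  assume nadj: "\<not> adjacent s u v"
  let ?P = "players n"
  define t where "t = insert v (s u)"
  define s' where "s' = s(u := t)"
  have conn: "connected (network n s)"
    and dev: "\<not> player_cost n b c s' u < player_cost n b c s u"
  proof -
    have "s u \<in> strategies n u"
      using nash u by (auto simp: nash_equilibrium_def strategy_combinations_def)
    then have "t \<in> strategies n u"
      using v \<open>u \<noteq> v\<close> by (auto simp: strategies_def t_def)
    then show "connected (network n s)" "\<not> player_cost n b c s' u < player_cost n b c s u"
      using nash u by (auto simp: nash_equilibrium_def s'_def)
  qed
  have "s u \<subseteq> ?P"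
    using nash u by (auto simp: nash_equilibrium_def strategy_combinations_def strategies_def)
  then have "finite (s u)" by (rule finite_subset) simp
  then have card: "card (s' u) = card (s u) + 1"
    using nadj by (simp add: s'_def t_def)
  have sub: "arcs (network n s) \<subseteq> arcs (network n s')"
    by (auto simp: s'_def t_def split: if_splits)
  \<comment> \<open>Only the strategy of \<open>u\<close> changed, so every new arc has
    \<open>u\<close> as an endpoint.\<close>
  have "betweenness n s' u \<le> betweenness n s u"
    unfolding betweenness_eq
    by (intro diff_left_mono sum_mono fraction_through_mono[OF sub]) (auto simp: s'_def t_def)
  then have betw: "b * betweenness n s' u \<le> b * betweenness n s u"
    using \<open>b \<ge> 0\<close> by (rule mult_left_mono)
  \<comment> \<open>The term of \<open>v\<close> is isolated: it drops by at least 1, and no other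
    term grows.\<close>
  have decomp: "closeness n x u =
      (distance n x u v - 1) + (\<Sum>w\<in>?P - {u} - {v}. distance n x u w - 1)" for x
    unfolding closeness_def using v \<open>u \<noteq> v\<close> by (intro sum.remove) auto
  have clos: "closeness n s' u + 1 \<le> closeness n s u"
  proof -
    have "distance n s' u v = 1"
      using u v \<open>u \<noteq> v\<close> by (intro distance_adjacent) (auto simp: s'_def t_def)
    then have "closeness n s' u + 1 = 1 + (\<Sum>w\<in>?P - {u} - {v}. distance n s' u w - 1)"
      by (simp add: decomp ac_simps one_ereal_def)
    also have "\<dots> \<le> (distance n s u v - 1) + (\<Sum>w\<in>?P - {u} - {v}. distance n s u w - 1)"
    proof (rule add_mono)
      have "2 \<le> distance n s u v" using \<open>u \<noteq> v\<close> nadj by (rule distance_ge_2)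
      then show "1 \<le> distance n s u v - 1"
        by (cases "distance n s u v") (auto simp: one_ereal_def)
    qed (intro sum_mono ereal_minus_mono distance_mono sub order_refl)
    finally show ?thesis by (simp only: decomp)
  qed
  \<comment> \<open>Finiteness is what lets a saving in closeness become a strict decrease of the
    cost.\<close>
  have "closeness n s u \<noteq> \<infinity>"
  proof
    assume "closeness n s u = \<infinity>"
    then obtain w where "w \<in> ?P" "distance n s u w - 1 = \<infinity>"
      by (auto simp: closeness_def sum_Pinfty)
    then show False
      using distance_finite[OF conn u, of w] by (cases "distance n s u w") (auto simp: one_ereal_def)
  qed
  then obtain r where r: "closeness n s u = ereal r"
    using closeness_nonneg[of n s u] by (cases "closeness n s u") auto
  then obtain r' where r': "closeness n s' u = ereal r'" "r' + 1 \<le> r"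
    using clos closeness_nonneg[of n s' u]
    by (cases "closeness n s' u") (auto simp: one_ereal_def)
  have "c * r' + c \<le> c * r"
    using mult_left_mono[OF r'(2), of c] \<open>c > 1\<close> by (simp add: algebra_simps)
  \<comment> \<open>The edge costs 1 and saves at least \<open>c\<close>, so \<open>c > 1\<close>
    makes the gain strict.\<close>
  then have "player_cost n b c s' u < player_cost n b c s u"
    using card betw \<open>c > 1\<close> by (simp add: player_cost_def r r')
  with dev show False by simp
qed

section \<open>Existence of an equilibrium\<close>

text \<open>Other players are at distance 1 from each other, which leaves no room for
  \<open>u\<close> in between. Adjacency to \<open>u\<close> is not assumed, so the lemma covers
  every deviation of \<open>u\<close> from a complete graph.\<close>

lemma betweenness_eq_of_adjacent:
  assumes "u \<in> players n"
    and adj: "\<And>i j. i \<in> players n - {u} \<Longrightarrow> j \<in> players n - {u} \<Longrightarrow> i \<noteq> j \<Longrightarrow> adjacent s i j"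
  shows "betweenness n s u = (real n - 1) * (real n - 2)"
proof -
  have "fraction_through n s u i j = 0"
    if i: "i \<in> players n - {u}" and j: "j \<in> players n - {u, i}" for i j
  proof -
    have "distance n s i j = 1"
      using i j adj[of i j] by (intro distance_adjacent) auto
    moreover have "1 \<le> distance n s u j" using j by (intro distance_ge_1) auto
    ultimately have "\<not> num_paths_through n s u i j > 0"
      using distance_less_of_through[of n s u i j] i by (auto simp: not_less[symmetric])
    then show ?thesis by (simp add: fraction_through_def)
  qed
  then show ?thesis by (simp add: betweenness_eq)
qed

text \<open>Makes the \<open>Max\<close> in the price of anarchy meaningful. A deviation leaves the
  betweenness of \<open>u\<close> unchanged, so only edges and closeness have to be
  compared.\<close>

lemma nash_equilibrium_exists:
  assumes "c \<ge> 1" "n \<ge> 2"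
  shows "\<exists>s. nash_equilibrium n b c s"
proof -
  let ?P = "players n"
  \<comment> \<open>Each edge is paid for by its smaller endpoint; \<open>restrict\<close> makes the
    profile extensional.\<close>
  define s :: profile where "s = restrict (\<lambda>u. {u<..<n}) ?P"
  have adj: "adjacent s u v" if "u \<in> ?P" "v \<in> ?P" "u \<noteq> v" for u v
    using that by (auto simp: s_def players_def)
  have comb: "s \<in> strategy_combinations n"
    by (auto simp: s_def strategy_combinations_def strategies_def players_def)
  have "strongly_connected (network n s)"
  proof (rule strongly_connectedI)
    interpret wf_digraph "network n s" by (rule wf_digraph_network)
    have "0 \<in> players n" using assms by (simp add: players_def)
    then show "verts (network n s) \<noteq> {}" by auto
    fix u v assume uv: "u \<in> verts (network n s)" "v \<in> verts (network n s)"
    show "u \<rightarrow>\<^sup>*\<^bsub>network n s\<^esub> v"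
    proof (cases "u = v")
      case False
      then have "awalk u [(u, v)] v"
        using uv adj by (auto simp: awalk_def)
      then show ?thesis by (rule reachable_awalkI)
    qed (use uv in simp)
  qed
  then have conn: "connected (network n s)"
    unfolding connected_def strongly_connected_def
    by (auto intro: wf_digraph.reachable_mk_symmetricI[OF wf_digraph_network])
  have "\<not> player_cost n b c (s(u := t)) u < player_cost n b c s u"
    if u: "u \<in> ?P" and t: "t \<in> strategies n u" for u t
  proof -
    let ?s' = "s(u := t)"
    have clos: "closeness n s u = 0"
      unfolding closeness_def
      by (intro sum.neutral ballI) (use adj u in \<open>simp add: distance_adjacent one_ereal_def\<close>)
    have betw: "betweenness n ?s' u = betweenness n s u"
      using u adj by (subst (1 2) betweenness_eq_of_adjacent) auto
    \<comment> \<open>Exactly the players who do not pay for \<open>u\<close> are paid for by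
      \<open>u\<close>, so \<open>edge_closeness_cost_ge\<close>, applied to the deviation, has the
      old edge cost on its left side.\<close>
    have "s u = {v \<in> ?P - {u}. u \<notin> ?s' v}"
      using u by (auto simp: s_def players_def)
    then have "ereal (real (card (s u))) \<le> ereal (real (card (?s' u))) + ereal c * closeness n ?s' u"
      using edge_closeness_cost_ge[of c ?s' u n] assms t by simp
    from add_left_mono[OF this, of "ereal b * ereal (betweenness n s u)"]
    have "player_cost n b c s u \<le> player_cost n b c ?s' u"
      by (simp only: player_cost_def clos betw ereal_zero_mult ereal_mult_zero add_0_left ac_simps)
    then show ?thesis by simp
  qed
  with comb conn show ?thesis by (auto simp: nash_equilibrium_def)
qed

section \<open>The price of anarchy\<close>

lemma finite_strategy_combinations: "finite (strategy_combinations n)"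
  unfolding strategy_combinations_def by (intro finite_PiE) (auto simp: strategies_def)

lemma price_of_anarchy_le_2:
  assumes "n \<ge> 2" "b \<ge> 0" "c > 1"
  shows "price_of_anarchy n b c \<le> 2"
proof -
  let ?N = "{s. nash_equilibrium n b c s}" and ?S = "strategy_combinations n"
  have NS: "?N \<subseteq> ?S" by (auto simp: nash_equilibrium_def)
  then have fin: "finite ?N" "finite ?S"
    by (auto intro: finite_subset finite_strategy_combinations)
  have ne: "?N \<noteq> {}" using nash_equilibrium_exists[of c n b] assms by auto
  with NS have ne': "?S \<noteq> {}" by auto
  have "Max (social_cost n b c ` ?N) \<in> social_cost n b c ` ?N"
    using fin ne by (intro Max_in) auto
  then obtain s where s: "nash_equilibrium n b c s" "Max (social_cost n b c ` ?N) = social_cost n b c s"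
    by auto
  have "Min (social_cost n b c ` ?S) \<in> social_cost n b c ` ?S"
    using fin ne' by (intro Min_in) auto
  then obtain t where t: "t \<in> ?S" "Min (social_cost n b c ` ?S) = social_cost n b c t"
    by auto
  have sS: "s \<in> ?S" using s NS by auto
  have upper: "social_cost n b c s \<le> ereal (complete_cost n b)"
    using assms sS nash_equilibrium_adjacent[OF s(1)] by (intro social_cost_complete_le) auto
  have lower: "ereal (complete_cost n b / 2) \<le> social_cost n b c x" if "x \<in> ?S" for x
    using assms that by (intro social_cost_ge) auto
  \<comment> \<open>Positivity keeps the minimal cost away from 0 in the quotient.\<close>
  have "0 < (real n - 1) + b * ((real n - 1) * (real n - 2))"
    using assms by (intro add_pos_nonneg mult_nonneg_nonneg) auto
  then have pos: "0 < complete_cost n b"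
    using assms by (simp add: complete_cost_def)
  obtain M where M: "social_cost n b c s = ereal M"
    using upper lower[OF sS] by (cases "social_cost n b c s") auto
  show ?thesis
  proof (cases "social_cost n b c t")
    case (real m)
    then have "complete_cost n b / 2 \<le> m" "M \<le> complete_cost n b"
      using upper lower[OF t(1)] M by auto
    then have "M / m \<le> 2" "m \<noteq> 0"
      using pos by (auto simp: divide_le_eq)
    then show ?thesis
      by (simp add: price_of_anarchy_def s t M real)
  next
    \<comment> \<open>A real number divided by infinity is 0 in \<open>ereal\<close>.\<close>
    case PInf
    then show ?thesis by (simp add: price_of_anarchy_def s t M)
  next
    case MInf
    then show ?thesis using lower[OF t(1)] by simp
  qed
qed

theorem corollary4:
  shows "\<exists>C::real. \<forall>(n::nat) (b::real) (c::real).
    n \<ge> 2 \<longrightarrow> b \<ge> 0 \<longrightarrow> c > 1 \<longrightarrow> price_of_anarchy n b c \<le> ereal C"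
  using price_of_anarchy_le_2 by (intro exI[of _ 2]) simp

end
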